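(* Let $d,m\ge 1$, let $P_1,\dots,P_m\subset\mathbb{R}^d$ be polytopes of positive dimension in general position, and let $S_1,\dots,S_m\subset\mathbb{R}^d$ be line segments (of positive length) in general position. Then the number of vertices of the Minkowski sum $P_1+\cdots+P_m$ is at least the number of vertices of the Minkowski sum $S_1+\cdots+S_m$.
   Context: General position. For a polytope $P\subset\mathbb{R}^d$ and a linear functional $u$ on $\mathbb{R}^d$, let $P^u$ denote the face of $P$ on which $u$ is maximal. A family $(P_1,\dots,P_m)$ of polytopes in $\mathbb{R}^d$ is in general position if for every nonzero $u$ each $P_i^u$ is a simplex and $\dim(P_1^u+\cdots+P_m^u)=\sum_{i=1}^m\dim P_i^u$. Equivalently, every proper face of the Cayley polytope $\mathrm{conv}\bigl(\bigcup_{i=1}^m P_i\times\{e_i\}\bigr)\subset\mathbb{R}^d\times\mathbb{R}^m$ that arises by maximizing a functional $(u,c)$ with $u\neq 0$ and that meets every $P_i\times\{e_i\}$ is a simplex (the "Cayley complex" is simplicial). For segments this means that any $\min(m,d)$ of their direction vectors are linearly independent. *)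

theory Defs
  imports "HOL-Analysis.Analysis"
begin

text \<open>
  Sums of sets are Minkowski sums (the instances of \<^theory>\<open>HOL-Library.Set_Algebras\<close>), and a vertex of
  a polytope is an extreme point. All families are indexed by \<open>{1..m}\<close>.
\<close>

definition max_face :: "('a::euclidean_space \<Rightarrow> real) \<Rightarrow> 'a set \<Rightarrow> 'a set" where
  "max_face u P = {x \<in> P. \<forall>y\<in>P. u y \<le> u x}"

definition general_position :: "nat \<Rightarrow> (nat \<Rightarrow> 'a::euclidean_space set) \<Rightarrow> bool" where
  "general_position m P \<longleftrightarrow>
    (\<forall>u :: 'a \<Rightarrow> real. linear u \<and> u \<noteq> (\<lambda>_. 0) \<longrightarrow>
      (\<forall>i\<in>{1..m}. \<exists>n. n simplex max_face u (P i)) \<and>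
      aff_dim (\<Sum>i\<in>{1..m}. max_face u (P i)) = (\<Sum>i\<in>{1..m}. aff_dim (max_face u (P i))))"

definition vertices :: "'a::euclidean_space set \<Rightarrow> 'a set" where
  "vertices P = {v. v extreme_point_of P}"

end

theory Submission
  imports Defs
begin

text \<open>
  A vertex of a Minkowski sum is a tuple of vertices of the summands, each of which is the unique
  maximum of one common functional; write \<open>d\<close> for the dimension.

  Both families are compared with the number of sets \<open>J \<subseteq> {1..<m}\<close> with \<open>card J < d\<close>. For segments,
  the tuples are sign patterns; up to the antipodal symmetry one may fix the sign of the last segment,
  and then a linear relation shows that no \<open>d\<close> further segments are shattered, so the count follows
  from Sauer's lemma. For the polytopes, group the tuples by the vertex \<open>a\<close> chosen in \<open>P m\<close>. A
  group has at least as many elements as strongly shattered sets, and general position makes \<open>J\<close>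
  strongly shattered in the group of \<open>a\<close> as soon as some \<open>u \<noteq> 0\<close> is maximal at \<open>a\<close> and at a
  non-vertex face of every \<open>P i\<close> with \<open>i \<in> J\<close>. It remains to see that every \<open>J\<close> is counted for
  two vertices \<open>a\<close>, that is, that the cone of all \<open>u\<close> whose faces \<open>P i\<close>, \<open>i \<in> J\<close>, are not vertices
  does not lie in an open half-space (up to the origin). This is a maximum principle, proved by
  induction on \<open>card J\<close>: at a farthest point of a compact slice of such a cone, the induction
  hypothesis for the faces of the polytopes provides a direction in which one can move farther.
\<close>

section \<open>Strongly shattered sets\<close>

text \<open>The whole cube of choices between \<open>p\<close> and \<open>q\<close> on
  \<open>J\<close> has one common extension off \<open>J\<close>, namely \<open>q\<close>. Ordinary
  shattering would let the values off \<open>J\<close> vary with \<open>K\<close>.\<close>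

definition strongly_shattered :: "('i \<Rightarrow> 'b) set \<Rightarrow> 'i set \<Rightarrow> bool" where
  "strongly_shattered A J \<longleftrightarrow>
    (\<exists>p q. (\<forall>i\<in>J. p i \<noteq> q i) \<and> (\<forall>K\<subseteq>J. (\<lambda>i. if i \<in> K then p i else q i) \<in> A))"

text \<open>Removing one chosen preimage per value from \<open>A\<close> still leaves a preimage of
  every value that had two.\<close>

lemma card_image_add_card_fibres_le:
  assumes "finite A"
  shows "card (r ` A) + card {g. \<exists>f\<in>A. \<exists>f'\<in>A. r f = g \<and> r f' = g \<and> f \<noteq> f'} \<le> card A"
proof -
  let ?\<sigma> = "inv_into A r" and ?B = "{g. \<exists>f\<in>A. \<exists>f'\<in>A. r f = g \<and> r f' = g \<and> f \<noteq> f'}"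
  let ?C = "?\<sigma> ` r ` A"
  have C: "?C \<subseteq> A"
    by (auto intro: inv_into_into)
  have "?B \<subseteq> r ` (A - ?C)"
  proof
    fix g assume "g \<in> ?B"
    then obtain f f' where f: "f \<in> A" "f' \<in> A" "r f = g" "r f' = g" "f \<noteq> f'"
      by blast
    have "f \<notin> ?C \<or> f' \<notin> ?C"
      using f by (auto simp: f_inv_into_f)
    then show "g \<in> r ` (A - ?C)"
    proof
      assume "f \<notin> ?C"
      with f show ?thesis
        by (intro image_eqI[of _ _ f]) auto
    next
      assume "f' \<notin> ?C"
      with f show ?thesis
        by (intro image_eqI[of _ _ f']) auto
    qed
  qed
  then have "card ?B \<le> card (A - ?C)"
    using assms by (meson card_image_le card_mono finite_Diff finite_imageI le_trans)
  moreover have "card ?C = card (r ` A)"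
    by (intro card_image inj_on_inv_into) auto
  moreover have "card (A - ?C) + card ?C = card A"
    using assms C by (metis card_Diff_subset card_mono finite_subset le_add_diff_inverse2)
  ultimately show ?thesis
    by simp
qed

text \<open>Delete a coordinate \<open>n\<close>: sets avoiding \<open>n\<close> stay strongly
  shattered in the projection, and sets containing \<open>n\<close>, once it is removed, are
  strongly shattered by the points with two lifts. The preceding count adds both bounds. This is the
  lower half of the sandwich theorem, for an arbitrary alphabet.\<close>

lemma card_strongly_shattered_le:
  assumes "finite N" and "finite A"
    and "\<And>f g i. f \<in> A \<Longrightarrow> g \<in> A \<Longrightarrow> i \<notin> N \<Longrightarrow> f i = g i"
    and "\<And>J. J \<in> \<J> \<Longrightarrow> J \<subseteq> N \<and> strongly_shattered A J"
  shows "card \<J> \<le> card A"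
  using assms
proof (induction N arbitrary: A \<J> rule: finite_induct)
  case empty
  show ?case
  proof (cases "\<J> = {}")
    case False
    have "J = {} \<and> strongly_shattered A {}" if "J \<in> \<J>" for J
      using empty(3)[OF that] by auto
    with False have "\<J> = {{}}" "strongly_shattered A {}"
      by blast+
    moreover from this(2) have "A \<noteq> {}"
      by (auto simp: strongly_shattered_def)
    then have "card A \<ge> 1"
      using empty(1) by (simp add: Suc_leI card_gt_0_iff)
    ultimately show ?thesis
      by simp
  qed simp
next
  case (insert n N)
  \<comment> \<open>Projection along \<open>n\<close> is modelled by overwriting with
    \<open>undefined\<close>, so that members of the image agree off \<open>N\<close>.\<close>
  define r where "r = (\<lambda>f :: 'a \<Rightarrow> 'b. f(n := undefined))"
  define A2 where "A2 = {g. \<exists>f\<in>A. \<exists>f'\<in>A. r f = g \<and> r f' = g \<and> f \<noteq> f'}"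
  define J1 where "J1 = {J \<in> \<J>. n \<notin> J}"
  define J2 where "J2 = {J \<in> \<J>. n \<in> J}"
  have A2: "A2 \<subseteq> r ` A"
    by (auto simp: A2_def)
  have agree: "f i = g i" if "f \<in> r ` A" "g \<in> r ` A" "i \<notin> N" for f g i
    using that insert.prems(2) by (auto simp: r_def)
  have "card J1 \<le> card (r ` A)"
  proof (rule insert.IH)
    fix J assume "J \<in> J1"
    then have J: "J \<subseteq> N" "n \<notin> J" "strongly_shattered A J"
      using insert.prems(3) by (auto simp: J1_def)
    then obtain p q where pq: "\<forall>i\<in>J. p i \<noteq> q i"
      "\<And>K. K \<subseteq> J \<Longrightarrow> (\<lambda>i. if i \<in> K then p i else q i) \<in> A"
      unfolding strongly_shattered_def by blast
    have "(\<lambda>i. if i \<in> K then r p i else r q i) \<in> r ` A" if "K \<subseteq> J" for K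
      using pq(2)[OF that] J(2) that by (intro image_eqI) (auto simp: r_def)
    moreover have "\<forall>i\<in>J. r p i \<noteq> r q i"
      using pq(1) J(2) by (auto simp: r_def)
    ultimately show "J \<subseteq> N \<and> strongly_shattered (r ` A) J"
      using J(1) unfolding strongly_shattered_def by blast
  qed (use insert.prems(1) agree in auto)
  moreover have "card ((\<lambda>J. J - {n}) ` J2) \<le> card A2"
  proof (rule insert.IH)
    fix J' assume "J' \<in> (\<lambda>J. J - {n}) ` J2"
    then obtain J where J: "J' = J - {n}" "n \<in> J" "J \<subseteq> insert n N" "strongly_shattered A J"
      using insert.prems(3) by (auto simp: J2_def)
    then obtain p q where pq: "\<forall>i\<in>J. p i \<noteq> q i"
      "\<And>K. K \<subseteq> J \<Longrightarrow> (\<lambda>i. if i \<in> K then p i else q i) \<in> A"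
      unfolding strongly_shattered_def by blast
    have "(\<lambda>i. if i \<in> K then r p i else r q i) \<in> A2" if K: "K \<subseteq> J'" for K
    proof -
      \<comment> \<open>The two lifts take the values \<open>q n\<close> and \<open>p n\<close> at
        \<open>n\<close> and agree elsewhere.\<close>
      let ?f = "\<lambda>i. if i \<in> K then p i else q i" and ?f' = "\<lambda>i. if i \<in> insert n K then p i else q i"
      have "?f \<in> A" "?f' \<in> A"
        using K J pq(2)[of K] pq(2)[of "insert n K"] by blast+
      moreover have "?f \<noteq> ?f'"
        using pq(1) K J by (auto simp: fun_eq_iff intro!: exI[of _ n])
      moreover have "r ?f = (\<lambda>i. if i \<in> K then r p i else r q i)"
        "r ?f' = (\<lambda>i. if i \<in> K then r p i else r q i)"
        using K J by (auto simp: r_def)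
      ultimately show ?thesis
        unfolding A2_def by (intro CollectI bexI[of _ ?f'] bexI[of _ ?f] conjI)
    qed
    moreover have "\<forall>i\<in>J'. r p i \<noteq> r q i"
      using pq(1) J by (auto simp: r_def)
    ultimately show "J' \<subseteq> N \<and> strongly_shattered A2 J'"
      using J unfolding strongly_shattered_def by blast
  next
    show "finite A2"
      using insert.prems(1) A2 finite_subset by blast
    show "f i = g i" if "f \<in> A2" "g \<in> A2" "i \<notin> N" for f g i
      using agree[of f g i] A2 that by blast
  qed
  moreover have "card ((\<lambda>J. J - {n}) ` J2) = card J2"
    by (rule card_image) (auto simp: inj_on_def J2_def)
  moreover have "card (r ` A) + card A2 \<le> card A"
    unfolding A2_def by (rule card_image_add_card_fibres_le) fact
  moreover have "card \<J> \<le> card J1 + card J2"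
  proof -
    have "\<J> = J1 \<union> J2"
      by (auto simp: J1_def J2_def)
    then show ?thesis
      by (simp add: card_Un_le)
  qed
  ultimately show ?case
    by linarith
qed

section \<open>Directions maximised at non-vertex faces\<close>

lemma max_face_scaleR:
  "t > 0 \<Longrightarrow> max_face ((\<bullet>) (t *\<^sub>R u)) V = max_face ((\<bullet>) u) V"
  by (auto simp: max_face_def)

lemma max_face_0: "max_face ((\<bullet>) 0) V = V"
  by (auto simp: max_face_def)

lemma max_face_singleton: "max_face u {a} = {a}"
  by (auto simp: max_face_def)

lemma max_face_nonempty:
  assumes "finite V" "V \<noteq> {}"
  shows "max_face ((\<bullet>) u) V \<noteq> {}"
proof -
  have "Max ((\<bullet>) u ` V) \<in> (\<bullet>) u ` V"
    using assms by (intro Max_in) auto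
  then obtain x where "x \<in> V" "u \<bullet> x = Max ((\<bullet>) u ` V)"
    by (metis imageE)
  then have "x \<in> max_face ((\<bullet>) u) V"
    using assms by (simp add: max_face_def)
  then show ?thesis
    by blast
qed

lemma finite_max_face: "finite V \<Longrightarrow> finite (max_face u V)"
  by (auto simp: max_face_def)

lemma max_face_subset: "max_face u V \<subseteq> V"
  by (auto simp: max_face_def)

lemma max_face_eq_singleton:
  assumes "finite V" "x \<in> max_face ((\<bullet>) u) V" "card (max_face ((\<bullet>) u) V) < 2"
  shows "max_face ((\<bullet>) u) V = {x}"
proof -
  have "card (max_face ((\<bullet>) u) V) \<noteq> 0"
    using assms finite_max_face by (metis card_0_eq empty_iff)
  then have "card (max_face ((\<bullet>) u) V) = 1"
    using assms(3) by linarith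
  then show ?thesis
    using assms(2) by (auto simp: card_1_singleton_iff)
qed

text \<open>By continuity a strict inequality at \<open>y\<close> survives for small
  \<open>e\<close>, while a tie at \<open>y\<close> is decided by \<open>v\<close> alone: the order
  becomes lexicographic.\<close>

lemma eventually_perturb_le_iff:
  fixes x y v z :: "'a::euclidean_space"
  shows "\<forall>\<^sub>F e in at_right 0. (y + e *\<^sub>R v) \<bullet> z \<le> (y + e *\<^sub>R v) \<bullet> x \<longleftrightarrow>
    y \<bullet> z < y \<bullet> x \<or> y \<bullet> z = y \<bullet> x \<and> v \<bullet> z \<le> v \<bullet> x"
proof -
  have lim: "((\<lambda>e. (y + e *\<^sub>R v) \<bullet> w) \<longlongrightarrow> (y + 0 *\<^sub>R v) \<bullet> w) (at_right 0)" for w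
    by (intro tendsto_intros)
  have *: "\<forall>\<^sub>F e in at_right 0. (y + e *\<^sub>R v) \<bullet> p < (y + e *\<^sub>R v) \<bullet> q" if "y \<bullet> p < y \<bullet> q" for p q
    using that order_tendstoD(1)[OF lim[of "q - p"], of 0] by (simp add: algebra_simps)
  consider "y \<bullet> z < y \<bullet> x" | "y \<bullet> x < y \<bullet> z" | "y \<bullet> z = y \<bullet> x"
    by linarith
  then show ?thesis
  proof cases
    case 3
    have "\<forall>\<^sub>F e::real in at_right 0. e > 0"
      by (simp add: eventually_at_right_less)
    then show ?thesis
      by eventually_elim (use 3 in \<open>simp add: inner_add_left\<close>)
  qed (auto intro: eventually_mono[OF *])
qed

text \<open>Finitely many comparisons share one range of small \<open>e\<close>. The lemma serves
  both to move inside a cone of directions and to break ties between vertices.\<close>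

lemma eventually_max_face_perturb:
  fixes y v :: "'a::euclidean_space"
  assumes "finite V"
  shows "\<forall>\<^sub>F e in at_right 0.
    max_face ((\<bullet>) (y + e *\<^sub>R v)) V = max_face ((\<bullet>) v) (max_face ((\<bullet>) y) V)"
proof -
  have "\<forall>\<^sub>F e in at_right 0. \<forall>x\<in>V. \<forall>z\<in>V. (y + e *\<^sub>R v) \<bullet> z \<le> (y + e *\<^sub>R v) \<bullet> x \<longleftrightarrow>
    y \<bullet> z < y \<bullet> x \<or> y \<bullet> z = y \<bullet> x \<and> v \<bullet> z \<le> v \<bullet> x"
    using assms by (intro eventually_ball_finite ballI eventually_perturb_le_iff)
  then show ?thesis
  proof eventually_elim
    case (elim e)
    show ?case
    proof (intro equalityI subsetI)
      fix x assume "x \<in> max_face ((\<bullet>) (y + e *\<^sub>R v)) V"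
      then have x: "x \<in> V"
        "\<And>z. z \<in> V \<Longrightarrow> y \<bullet> z < y \<bullet> x \<or> y \<bullet> z = y \<bullet> x \<and> v \<bullet> z \<le> v \<bullet> x"
        using elim by (auto simp: max_face_def)
      then show "x \<in> max_face ((\<bullet>) v) (max_face ((\<bullet>) y) V)"
        unfolding max_face_def by fastforce
    next
      fix x assume x: "x \<in> max_face ((\<bullet>) v) (max_face ((\<bullet>) y) V)"
      have "y \<bullet> z < y \<bullet> x \<or> y \<bullet> z = y \<bullet> x \<and> v \<bullet> z \<le> v \<bullet> x" if "z \<in> V" for z
      proof (cases "y \<bullet> z < y \<bullet> x")
        case False
        then have "z \<in> max_face ((\<bullet>) y) V" "y \<bullet> z = y \<bullet> x"
          using x that by (fastforce simp: max_face_def)+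
        then show ?thesis
          using x by (simp add: max_face_def)
      qed simp
      then show "x \<in> max_face ((\<bullet>) (y + e *\<^sub>R v)) V"
        using elim x by (simp add: max_face_def)
    qed
  qed
qed

section \<open>Closed cones of directions\<close>

lemma closed_mem_max_face: "closed {u. x \<in> max_face ((\<bullet>) u) V}"
proof -
  have "closed (\<Inter>y\<in>V. {u. u \<bullet> y \<le> u \<bullet> x})"
    by (intro closed_INT ballI closed_Collect_le continuous_intros)
  moreover have "{u. x \<in> max_face ((\<bullet>) u) V} =
      (if x \<in> V then \<Inter>y\<in>V. {u. u \<bullet> y \<le> u \<bullet> x} else {})"
    by (auto simp: max_face_def)
  ultimately show ?thesis
    by simp
qed

lemma closed_card_max_face_ge_2:
  assumes "finite V"
  shows "closed {u. 2 \<le> card (max_face ((\<bullet>) u) V)}"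
proof -
  have "2 \<le> card (max_face ((\<bullet>) u) V) \<longleftrightarrow>
      (\<exists>x\<in>V. \<exists>y\<in>V - {x}. x \<in> max_face ((\<bullet>) u) V \<and> y \<in> max_face ((\<bullet>) u) V)" for u
  proof -
    have "2 \<le> card (max_face ((\<bullet>) u) V) \<longleftrightarrow> (\<exists>x y. x \<noteq> y \<and> {x, y} \<subseteq> max_face ((\<bullet>) u) V)"
    proof
      assume "2 \<le> card (max_face ((\<bullet>) u) V)"
      then obtain T where "T \<subseteq> max_face ((\<bullet>) u) V" "card T = 2"
        by (meson obtain_subset_with_card_n)
      then show "\<exists>x y. x \<noteq> y \<and> {x, y} \<subseteq> max_face ((\<bullet>) u) V"
        by (auto simp: card_2_iff)
    next
      assume "\<exists>x y. x \<noteq> y \<and> {x, y} \<subseteq> max_face ((\<bullet>) u) V"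
      then obtain x y where "x \<noteq> y" "{x, y} \<subseteq> max_face ((\<bullet>) u) V"
        by blast
      then show "2 \<le> card (max_face ((\<bullet>) u) V)"
        using card_mono[OF finite_max_face[OF assms], of "{x, y}" "(\<bullet>) u"] by simp
    qed
    then show ?thesis
      using max_face_subset[of "(\<bullet>) u" V] by blast
  qed
  then have "{u. 2 \<le> card (max_face ((\<bullet>) u) V)} = (\<Union>x\<in>V. \<Union>y\<in>V - {x}.
      {u. x \<in> max_face ((\<bullet>) u) V} \<inter> {u. y \<in> max_face ((\<bullet>) u) V})"
    by blast
  then show ?thesis
    using assms by (auto intro!: closed_Union closed_Int closed_mem_max_face)
qed

text \<open>The unit vectors of a closed cone form a compact set, on which \<open>e\<close> has a
  positive minimum; homogeneity does the rest. The bound leaves room for tilting a functional and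
  makes slices of a cone bounded.\<close>

lemma cone_pos_lower_bound:
  fixes C :: "'a::euclidean_space set"
  assumes "closed C" "cone C" and pos: "\<And>u. u \<in> C \<Longrightarrow> u \<noteq> 0 \<Longrightarrow> e \<bullet> u > 0"
  obtains \<mu> where "\<mu> > 0" "\<And>u. u \<in> C \<Longrightarrow> \<mu> * norm u \<le> e \<bullet> u"
proof (cases "C \<inter> sphere 0 1 = {}")
  case True
  have "u = 0" if "u \<in> C" for u
  proof (rule ccontr)
    assume "u \<noteq> 0"
    then have "(1 / norm u) *\<^sub>R u \<in> C \<inter> sphere 0 1"
      using \<open>cone C\<close> that by (auto simp: cone_def)
    with True show False
      by blast
  qed
  then show ?thesis
    using that[of 1] by fastforce
next
  case False
  have "compact (C \<inter> sphere 0 1)"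
    using \<open>closed C\<close> by (simp add: closed_Int_compact)
  moreover have "continuous_on (C \<inter> sphere 0 1) ((\<bullet>) e)"
    by (intro continuous_intros)
  ultimately obtain y where y: "y \<in> C \<inter> sphere 0 1" "\<forall>u \<in> C \<inter> sphere 0 1. e \<bullet> y \<le> e \<bullet> u"
    using continuous_attains_inf False by blast
  show ?thesis
  proof (rule that[of "e \<bullet> y"])
    show "e \<bullet> y > 0"
      using y(1) by (intro pos) auto
    fix u assume u: "u \<in> C"
    show "(e \<bullet> y) * norm u \<le> e \<bullet> u"
    proof (cases "u = 0")
      case False
      then have "(1 / norm u) *\<^sub>R u \<in> C \<inter> sphere 0 1"
        using \<open>cone C\<close> u by (auto simp: cone_def)
      then have "e \<bullet> y \<le> e \<bullet> ((1 / norm u) *\<^sub>R u)"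
        using y(2) by blast
      with False show ?thesis
        by (simp add: field_simps)
    qed simp
  qed
qed

section \<open>The maximum principle\<close>

lemma dim_Int_hyperplane_ge:
  fixes W :: "'a::euclidean_space set"
  assumes "subspace W"
  shows "dim W \<le> dim (W \<inter> {x. e \<bullet> x = 0}) + 1"
proof (cases "e = 0")
  case False
  have "dim {x + y |x y. x \<in> W \<and> y \<in> {x. e \<bullet> x = 0}} + dim (W \<inter> {x. e \<bullet> x = 0})
      = dim W + (DIM('a) - 1)"
    using dim_sums_Int[OF assms subspace_hyperplane[of e]] dim_hyperplane[OF False] by simp
  moreover have "dim {x + y |x y. x \<in> W \<and> y \<in> {x. e \<bullet> x = 0}} \<le> DIM('a)"
    by (rule dim_subset_UNIV)
  ultimately show ?thesis
    by linarith
qed simp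

text \<open>The free choice of \<open>s\<close> expresses that no open half-space contains the cone
  without its origin. \<open>W\<close> and \<open>V\<close> are arbitrary for the sake of the
  induction, which passes to a hyperplane section of \<open>W\<close> and to faces of the
  \<open>V i\<close>.\<close>

lemma exists_common_nonvertex_direction:
  fixes V :: "'i \<Rightarrow> 'a::euclidean_space set"
  assumes "finite I" and "\<And>i. i \<in> I \<Longrightarrow> finite (V i) \<and> 2 \<le> card (V i)"
    and "subspace W" and "card I < dim W"
  shows "\<exists>u\<in>W. u \<noteq> 0 \<and> s \<bullet> u \<le> 0 \<and> (\<forall>i\<in>I. 2 \<le> card (max_face ((\<bullet>) u) (V i)))"
  using assms
proof (induction I arbitrary: V W s rule: finite_induct)
  case empty
  then obtain w where w: "w \<in> W" "w \<noteq> 0"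
    by (metis card.empty dim_eq_0 less_irrefl subsetI singletonI)
  show ?case
  proof (cases "s \<bullet> w \<le> 0")
    case False
    then show ?thesis
      using w \<open>subspace W\<close> by (intro bexI[of _ "- w"]) (auto simp: subspace_neg)
  qed (use w in auto)
next
  case (insert k I)
  \<comment> \<open>By the induction hypothesis \<open>K\<close> meets every closed half-space
    through the origin in a nonzero point; \<open>T\<close> is the cone for which this is to be
    shown.\<close>
  define K where "K = {u \<in> W. \<forall>i\<in>I. 2 \<le> card (max_face ((\<bullet>) u) (V i))}"
  define T where "T = {u \<in> K. 2 \<le> card (max_face ((\<bullet>) u) (V k))}"
  have Vk: "finite (V k)" "2 \<le> card (V k)"
    using insert.prems(1) by auto
  have W: "closed W"
    using insert.prems(2) by (simp add: closed_subspace)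
  have K: "closed K"
  proof -
    have "K = W \<inter> (\<Inter>i\<in>I. {u. 2 \<le> card (max_face ((\<bullet>) u) (V i))})"
      by (auto simp: K_def)
    then show ?thesis
      using W insert.prems(1) by (auto intro!: closed_Int closed_INT closed_card_max_face_ge_2)
  qed
  \<comment> \<open>At \<open>t = 0\<close> every face is the whole \<open>V i\<close>, which has
    two points, so the origin belongs to the cone.\<close>
  have coneK: "t *\<^sub>R u \<in> K" if "u \<in> K" "t \<ge> 0" for t u
    using that insert.prems(1,2)
    by (cases "t = 0") (auto simp: K_def max_face_scaleR max_face_0 subspace_scale subspace_0)
  have T: "closed T" "cone T"
  proof -
    have "T = K \<inter> {u. 2 \<le> card (max_face ((\<bullet>) u) (V k))}"
      by (auto simp: T_def)
    then show "closed T"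
      using K Vk by (auto intro!: closed_Int closed_card_max_face_ge_2)
    have "t *\<^sub>R u \<in> T" if "u \<in> T" "t \<ge> 0" for t u
      using that coneK[of u t] Vk by (cases "t = 0") (auto simp: T_def max_face_scaleR max_face_0)
    then show "cone T"
      by (auto simp: cone_def)
  qed
  show ?case
  proof (rule ccontr)
    assume contra: "\<not> ?thesis"
    have "s \<bullet> u > 0" if "u \<in> T" "u \<noteq> 0" for u
      using contra that by (force simp: T_def K_def)
    then obtain \<mu> where \<mu>: "\<mu> > 0" "\<And>u. u \<in> T \<Longrightarrow> \<mu> * norm u \<le> s \<bullet> u"
      using cone_pos_lower_bound[OF T] by blast
    have "\<exists>u\<in>W. u \<noteq> 0 \<and> s \<bullet> u \<le> 0 \<and> (\<forall>i\<in>I. 2 \<le> card (max_face ((\<bullet>) u) (V i)))"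
      using insert.prems insert.hyps by (intro insert.IH) auto
    then obtain u0 where u0: "u0 \<in> K" "u0 \<noteq> 0" "s \<bullet> u0 \<le> 0"
      by (auto simp: K_def)
    text \<open>Tilting \<open>s\<close> makes \<open>u0\<close> strictly negative while keeping \<open>T\<close> on the positive side.\<close>
    define s' where "s' = s - (\<mu> / (2 * norm u0)) *\<^sub>R u0"
    have s'u0: "s' \<bullet> u0 < 0"
    proof -
      have "s' \<bullet> u0 = s \<bullet> u0 - \<mu> / (2 * norm u0) * (norm u0)\<^sup>2"
        by (simp add: s'_def inner_diff_left power2_norm_eq_inner)
      also have "\<dots> = s \<bullet> u0 - \<mu> * norm u0 / 2"
        using u0(2) by (simp add: power2_eq_square)
      also have "\<dots> < 0"
        using u0 \<mu>(1) by (smt (verit) half_gt_zero mult_pos_pos zero_less_norm_iff)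
      finally show ?thesis .
    qed
    have s'T: "s' \<bullet> u > 0" if "u \<in> T" "u \<noteq> 0" for u
    proof -
      have "\<mu> / (2 * norm u0) * (u0 \<bullet> u) \<le> \<mu> / (2 * norm u0) * (norm u0 * norm u)"
        using \<mu>(1) by (intro mult_left_mono norm_cauchy_schwarz) auto
      also have "\<dots> = \<mu> * norm u / 2"
        using u0 by simp
      also have "\<dots> < \<mu> * norm u"
        using \<mu>(1) that by simp
      also have "\<dots> \<le> s \<bullet> u"
        using \<mu>(2) that by blast
      finally show ?thesis
        by (simp add: s'_def inner_diff_left)
    qed
    \<comment> \<open>If the claim fails, the face of \<open>V k\<close> is a single point
      throughout this side of \<open>K\<close>.\<close>
    have notT: "card (max_face ((\<bullet>) u) (V k)) < 2" if "u \<in> K" "u \<noteq> 0" "s' \<bullet> u \<le> 0" for u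
      using s'T[of u] that by (force simp: T_def)
    obtain a where a: "a \<in> max_face ((\<bullet>) u0) (V k)"
      using max_face_nonempty[OF Vk(1), of u0] Vk by fastforce
    \<comment> \<open>Any second point will do: where \<open>a\<close> is the only maximiser,
      \<open>a - b\<close> is positive, so it cuts a bounded slice out of the cone \<open>D\<close>
      below.\<close>
    obtain b where b: "b \<in> V k" "b \<noteq> a"
      using Vk by (metis card_le_Suc0_iff_eq not_less_eq_eq numeral_2_eq_2)
    define D where "D = {u \<in> K. a \<in> max_face ((\<bullet>) u) (V k) \<and> s' \<bullet> u \<le> 0}"
    have sing: "max_face ((\<bullet>) u) (V k) = {a}" if "u \<in> D" "u \<noteq> 0" for u
      using that notT[of u] max_face_eq_singleton[OF Vk(1)] by (auto simp: D_def)
    have aV: "a \<in> V k"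
      using a max_face_subset by blast
    have pos: "(a - b) \<bullet> u > 0" if u: "u \<in> D" "u \<noteq> 0" for u
    proof (rule ccontr)
      assume "\<not> (a - b) \<bullet> u > 0"
      then have "u \<bullet> a \<le> u \<bullet> b"
        by (simp add: inner_diff_left inner_commute[of u])
      moreover have "\<forall>y\<in>V k. u \<bullet> y \<le> u \<bullet> a"
        using sing[OF u] by (auto simp: max_face_def)
      ultimately have "b \<in> max_face ((\<bullet>) u) (V k)"
        using b(1) by (fastforce simp: max_face_def)
      with sing[OF u] b(2) show False
        by blast
    qed
    have D: "closed D" "cone D"
    proof -
      have "D = K \<inter> {u. a \<in> max_face ((\<bullet>) u) (V k)} \<inter> {u. s' \<bullet> u \<le> 0}"
        by (auto simp: D_def)
      then show "closed D"
        using K by (auto intro!: closed_Int closed_mem_max_face closed_halfspace_le)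
      have "t *\<^sub>R u \<in> D" if "u \<in> D" "t \<ge> 0" for t u
        using that coneK[of u t] aV
        by (cases "t = 0") (auto simp: D_def max_face_scaleR max_face_0 mult_nonneg_nonpos)
      then show "cone D"
        by (auto simp: cone_def)
    qed
    obtain \<nu> where \<nu>: "\<nu> > 0" "\<And>u. u \<in> D \<Longrightarrow> \<nu> * norm u \<le> (a - b) \<bullet> u"
      using cone_pos_lower_bound[OF D pos] by blast
    define D1 where "D1 = D \<inter> {u. (a - b) \<bullet> u = 1}"
    have bound: "norm u \<le> 1 / \<nu>" if "u \<in> D1" for u
      using \<nu> that by (auto simp: D1_def field_simps dest!: \<nu>(2))
    have "compact D1"
    proof -
      have "bounded D1"
        using bound by (auto simp: bounded_iff)
      moreover have "closed D1"
        unfolding D1_def using D by (intro closed_Int closed_hyperplane)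
      ultimately show ?thesis
        by (simp add: compact_eq_bounded_closed)
    qed
    have u0D: "u0 \<in> D"
      using u0 a s'u0 by (auto simp: D_def)
    define u1 where "u1 = (1 / ((a - b) \<bullet> u0)) *\<^sub>R u0"
    have u1: "u1 \<in> D1" "s' \<bullet> u1 < 0"
      using D(2) u0D pos[OF u0D u0(2)] s'u0
      by (auto simp: u1_def D1_def cone_def divide_neg_pos)
    text \<open>The constant is so large that a farthest point from \<open>M *\<^sub>R s'\<close> cannot lie on the
      boundary hyperplane of \<open>s'\<close>.\<close>
    define M where "M = (1 / \<nu>)\<^sup>2 / (- (s' \<bullet> u1))"
    have "continuous_on D1 (\<lambda>u. norm (u - M *\<^sub>R s'))"
      by (intro continuous_intros)
    then obtain y where y: "y \<in> D1" and ymax: "\<And>u. u \<in> D1 \<Longrightarrow> norm (u - M *\<^sub>R s') \<le> norm (y - M *\<^sub>R s')"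
      using continuous_attains_sup[OF \<open>compact D1\<close>] u1(1) by blast
    have expand: "(norm (u - M *\<^sub>R s'))\<^sup>2 = (norm u)\<^sup>2 - 2 * M * (s' \<bullet> u) + (norm (M *\<^sub>R s'))\<^sup>2" for u
      unfolding power2_norm_eq_inner by (simp add: algebra_simps inner_commute)
    \<comment> \<open>With the constraint given by \<open>s'\<close> inactive at \<open>y\<close>, a
      small move cannot leave the half-space.\<close>
    have "s' \<bullet> y < 0"
    proof (rule ccontr)
      assume "\<not> s' \<bullet> y < 0"
      then have "s' \<bullet> y = 0"
        using y by (auto simp: D1_def D_def)
      moreover have "(norm (u1 - M *\<^sub>R s'))\<^sup>2 \<le> (norm (y - M *\<^sub>R s'))\<^sup>2"
        using ymax[OF u1(1)] by (simp add: power_mono)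
      ultimately have "(norm u1)\<^sup>2 - 2 * M * (s' \<bullet> u1) \<le> (norm y)\<^sup>2"
        by (simp add: expand)
      also have "\<dots> \<le> (1 / \<nu>)\<^sup>2"
        using bound[OF y] by (intro power_mono) auto
      \<comment> \<open>By the choice of \<open>M\<close>, the term
        \<open>- 2 * M * (s' \<bullet> u1)\<close> equals
        \<open>2 * (1 / \<nu>)\<^sup>2\<close>.\<close>
      finally have "(norm u1)\<^sup>2 + 2 * (1 / \<nu>)\<^sup>2 \<le> (1 / \<nu>)\<^sup>2"
        using u1(2) by (simp add: M_def)
      moreover have "(1 / \<nu>)\<^sup>2 > 0"
        using \<nu>(1) by simp
      ultimately show False
        by (smt (verit) zero_le_power2)
    qed
    have y0: "y \<noteq> 0"
      using y by (auto simp: D1_def)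
    have yD: "y \<in> D" "y \<in> K"
      using y by (auto simp: D1_def D_def)
    \<comment> \<open>Orthogonality to \<open>a - b\<close> keeps the move in the slice, using the
      faces at \<open>y\<close> keeps it in \<open>K\<close>, and the sign condition prevents it
      from approaching \<open>M *\<^sub>R s'\<close>. One index is lost against at most one
      dimension.\<close>
    have "\<exists>v\<in>W \<inter> {x. (a - b) \<bullet> x = 0}. v \<noteq> 0 \<and> (M *\<^sub>R s' - y) \<bullet> v \<le> 0 \<and>
        (\<forall>i\<in>I. 2 \<le> card (max_face ((\<bullet>) v) (max_face ((\<bullet>) y) (V i))))"
    proof (rule insert.IH)
      show "finite (max_face ((\<bullet>) y) (V i)) \<and> 2 \<le> card (max_face ((\<bullet>) y) (V i))" if "i \<in> I" for i
        using that insert.prems(1) yD(2) by (auto simp: K_def intro: finite_max_face)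
      show "subspace (W \<inter> {x. (a - b) \<bullet> x = 0})"
        using insert.prems(2) by (intro subspace_inter subspace_hyperplane)
      show "card I < dim (W \<inter> {x. (a - b) \<bullet> x = 0})"
        using insert.prems(2,3) insert.hyps dim_Int_hyperplane_ge[of W "a - b"] by auto
    qed
    then obtain v where v: "v \<in> W" "(a - b) \<bullet> v = 0" "v \<noteq> 0" "(M *\<^sub>R s' - y) \<bullet> v \<le> 0"
      "\<And>i. i \<in> I \<Longrightarrow> 2 \<le> card (max_face ((\<bullet>) v) (max_face ((\<bullet>) y) (V i)))"
      by blast
    have "\<forall>\<^sub>F e in at_right 0. \<forall>i\<in>insert k I.
        max_face ((\<bullet>) (y + e *\<^sub>R v)) (V i) = max_face ((\<bullet>) v) (max_face ((\<bullet>) y) (V i))"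
      using insert.prems(1) insert.hyps
      by (intro eventually_ball_finite ballI eventually_max_face_perturb) auto
    moreover have "\<forall>\<^sub>F e in at_right 0. s' \<bullet> (y + e *\<^sub>R v) < 0"
    proof (rule order_tendstoD(2))
      show "((\<lambda>e. s' \<bullet> (y + e *\<^sub>R v)) \<longlongrightarrow> s' \<bullet> (y + 0 *\<^sub>R v)) (at_right 0)"
        by (intro tendsto_intros)
      show "s' \<bullet> (y + 0 *\<^sub>R v) < 0"
        using \<open>s' \<bullet> y < 0\<close> by simp
    qed
    moreover have "\<forall>\<^sub>F e::real in at_right 0. e > 0"
      by (simp add: eventually_at_right_less)
    ultimately have "\<forall>\<^sub>F e in at_right 0. e > 0 \<and> s' \<bullet> (y + e *\<^sub>R v) < 0 \<and> (\<forall>i\<in>insert k I.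
        max_face ((\<bullet>) (y + e *\<^sub>R v)) (V i) = max_face ((\<bullet>) v) (max_face ((\<bullet>) y) (V i)))"
      by eventually_elim blast
    then obtain e where e: "e > 0" "s' \<bullet> (y + e *\<^sub>R v) < 0" "\<And>i. i \<in> insert k I \<Longrightarrow>
        max_face ((\<bullet>) (y + e *\<^sub>R v)) (V i) = max_face ((\<bullet>) v) (max_face ((\<bullet>) y) (V i))"
      using eventually_happens'[OF trivial_limit_at_right_real] by blast
    have "y + e *\<^sub>R v \<in> K"
      using v e(3) yD insert.prems(2) by (auto simp: K_def subspace_add subspace_scale)
    \<comment> \<open>The face of \<open>V k\<close> at \<open>y\<close> is already the single point
      \<open>a\<close>, so the perturbation cannot change it.\<close>
    moreover have "a \<in> max_face ((\<bullet>) (y + e *\<^sub>R v)) (V k)"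
      using e(3)[of k] sing[OF yD(1) y0] by (simp add: max_face_singleton)
    ultimately have "y + e *\<^sub>R v \<in> D1"
      using e(2) v(2) y by (simp add: D1_def D_def inner_add_right)
    then have "norm ((y - M *\<^sub>R s') + e *\<^sub>R v) \<le> norm (y - M *\<^sub>R s')"
      using ymax[of "y + e *\<^sub>R v"] by (simp add: algebra_simps)
    then have "(norm ((y - M *\<^sub>R s') + e *\<^sub>R v))\<^sup>2 \<le> (norm (y - M *\<^sub>R s'))\<^sup>2"
      by (simp add: power_mono)
    moreover have "(norm ((y - M *\<^sub>R s') + e *\<^sub>R v))\<^sup>2
        = (norm (y - M *\<^sub>R s'))\<^sup>2 + 2 * e * ((y - M *\<^sub>R s') \<bullet> v) + e\<^sup>2 * (norm v)\<^sup>2"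
      unfolding power2_norm_eq_inner
      by (simp add: inner_add_left inner_add_right inner_commute power2_eq_square)
    moreover have "2 * e * ((y - M *\<^sub>R s') \<bullet> v) \<ge> 0"
      using e(1) v(4) by (simp add: inner_diff_left)
    moreover have "e\<^sup>2 * (norm v)\<^sup>2 > 0"
      using e(1) v(3) by simp
    ultimately show False
      by linarith
  qed
qed

section \<open>Vertices of zonotopes\<close>

lemma exists_linear_relation:
  fixes s :: "'i \<Rightarrow> 'a::euclidean_space"
  assumes "finite I" "DIM('a) < card I"
  shows "\<exists>t. (\<exists>i\<in>I. t i \<noteq> 0) \<and> (\<Sum>i\<in>I. t i *\<^sub>R s i) = 0"
proof (cases "inj_on s I")
  case True
  have "dependent (s ` I)"
    using assms by (intro dependent_biggerset) (simp add: card_image[OF True])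
  then obtain c where "\<exists>v\<in>s ` I. c v \<noteq> 0" "(\<Sum>v\<in>s ` I. c v *\<^sub>R v) = 0"
    using assms(1) by (auto simp: dependent_finite)
  then show ?thesis
    by (intro exI[of _ "c \<circ> s"]) (simp add: sum.reindex[OF True])
next
  \<comment> \<open>A repeated vector is invisible to the set-based \<open>dependent\<close>; it
    gives a relation with coefficients \<open>1\<close> and \<open>- 1\<close>.\<close>
  case False
  then obtain i j where ij: "i \<in> I" "j \<in> I" "i \<noteq> j" "s i = s j"
    by (auto simp: inj_on_def)
  let ?t = "\<lambda>l. if l = i then 1 else if l = j then - 1 else 0 :: real"
  have "(\<Sum>l\<in>I. ?t l *\<^sub>R s l) = (\<Sum>l\<in>{i, j}. ?t l *\<^sub>R s l)"
    using assms(1) ij by (intro sum.mono_neutral_right) auto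
  also have "\<dots> = 0"
    using ij by simp
  finally show ?thesis
    using ij(1) by (intro exI[of _ ?t]) auto
qed

text \<open>Sauer's lemma. Because the sign at \<open>k\<close> is fixed, \<open>s k\<close> can
  join the linear relation, so sets with only \<open>DIM('a)\<close> elements already fail to be
  shattered.\<close>

lemma card_positive_sign_patterns_le:
  fixes s :: "'i \<Rightarrow> 'a::euclidean_space"
  assumes "finite N" "k \<notin> N"
  shows "card {X. X \<subseteq> N \<and> (\<exists>c. c \<bullet> s k > 0 \<and> (\<forall>i\<in>N. if i \<in> X then c \<bullet> s i > 0 else c \<bullet> s i < 0))}
    \<le> card {J. J \<subseteq> N \<and> card J < DIM('a)}" (is "card ?F \<le> card ?J")
proof -
  define F where "F = ?F"
  define \<J> where "\<J> = ?J"
  let ?G = "Pow N - F" and ?L = "Pow N - \<J>"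
  have sub: "F \<subseteq> Pow N" "\<J> \<subseteq> Pow N"
    by (auto simp: F_def \<J>_def)
  have unshattered: "\<exists>K\<subseteq>J. \<forall>X\<in>F. X \<inter> J \<noteq> K" if J: "J \<subseteq> N" "DIM('a) \<le> card J" for J
  proof -
    have "finite J" "k \<notin> J"
      using J assms finite_subset by auto
    then obtain t where t: "\<exists>i\<in>insert k J. t i \<noteq> 0" "(\<Sum>i\<in>insert k J. t i *\<^sub>R s i) = 0"
      using exists_linear_relation[of "insert k J" s] J by auto
    have "\<exists>t. (\<exists>i\<in>insert k J. t i \<noteq> 0) \<and> (\<Sum>i\<in>insert k J. t i *\<^sub>R s i) = 0 \<and> t k \<ge> 0"
    proof (cases "t k \<ge> 0")
      case False
      then show ?thesis
        using t by (intro exI[of _ "\<lambda>i. - t i"]) (simp add: sum_negf del: sum.insert)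
    qed (use t in blast)
    then obtain t where t: "\<exists>i\<in>insert k J. t i \<noteq> 0" "(\<Sum>i\<in>insert k J. t i *\<^sub>R s i) = 0" "t k \<ge> 0"
      by blast
    show ?thesis
    \<comment> \<open>The missing pattern follows the signs of the relation: with
      \<open>t k \<ge> 0\<close>, all terms \<open>t i * (c \<bullet> s i)\<close> would be
      nonnegative and one of them positive, although they sum to zero.\<close>
    proof (intro exI[of _ "{i \<in> J. t i > 0}"] conjI ballI notI)
      fix X assume "X \<in> F" and X: "X \<inter> J = {i \<in> J. t i > 0}"
      then obtain c where c: "c \<bullet> s k > 0" "\<forall>i\<in>N. if i \<in> X then c \<bullet> s i > 0 else c \<bullet> s i < 0"
        unfolding F_def by blast
      have nonneg: "t i * (c \<bullet> s i) \<ge> 0" if "i \<in> insert k J" for i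
      proof (cases "i = k")
        case False
        with that J have "i \<in> J" "i \<in> N"
          by auto
        then have "t i > 0 \<longleftrightarrow> i \<in> X" "if i \<in> X then c \<bullet> s i > 0 else c \<bullet> s i < 0"
          using X c(2) by blast+
        then show ?thesis
          by (cases "i \<in> X") (auto simp: not_less intro: mult_nonpos_nonpos)
      qed (use c t in simp)
      obtain i where i: "i \<in> insert k J" "t i \<noteq> 0"
        using t(1) by blast
      have "c \<bullet> s i \<noteq> 0"
        using i(1) c J by (fastforce split: if_splits)
      then have "t i * (c \<bullet> s i) > 0"
        using i nonneg[of i] by (simp add: less_le)
      then have "(\<Sum>i\<in>insert k J. t i * (c \<bullet> s i)) > 0"
        using \<open>finite J\<close> i(1) nonneg by (intro sum_pos2[of _ i]) auto
      moreover have "(\<Sum>i\<in>insert k J. t i * (c \<bullet> s i)) = c \<bullet> (\<Sum>i\<in>insert k J. t i *\<^sub>R s i)"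
        by (simp add: inner_sum_right del: sum.insert)
      ultimately show False
        using t(2) by simp
    qed blast
  qed
  text \<open>A set is shattered by a family unless its complement is strongly shattered by the
    complementary family.\<close>
  have "card ((\<lambda>J. N - J) ` ?L) \<le> card ((\<lambda>X i. i \<in> X) ` ?G)"
  proof (rule card_strongly_shattered_le)
    fix L assume "L \<in> (\<lambda>J. N - J) ` ?L"
    then obtain J where "J \<in> ?L" "L = N - J"
      by blast
    then have J: "J \<subseteq> N" "DIM('a) \<le> card J" "L = N - J"
      by (auto simp: \<J>_def)
    from unshattered[OF J(1,2)] obtain K where K: "K \<subseteq> J" "\<forall>X\<in>F. X \<inter> J \<noteq> K"
      by blast
    \<comment> \<open>Every \<open>M \<union> K\<close> with \<open>M \<subseteq> N - J\<close> has
      trace \<open>K\<close> on \<open>J\<close> and hence misses \<open>F\<close>.\<close>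
    have "(\<lambda>i. if i \<in> M then True else i \<in> K) \<in> (\<lambda>X i. i \<in> X) ` ?G" if M: "M \<subseteq> L" for M
    proof (rule image_eqI)
      have "(M \<union> K) \<inter> J = K"
        using M J K(1) by blast
      then show "M \<union> K \<in> ?G"
        using K M J by blast
    qed auto
    moreover have "\<forall>i\<in>L. True \<noteq> (i \<in> K)"
      using K J by blast
    ultimately show "L \<subseteq> N \<and> strongly_shattered ((\<lambda>X i. i \<in> X) ` ?G) L"
      unfolding strongly_shattered_def using J(3)
      by (intro conjI exI[of _ "\<lambda>_. True"] exI[of _ "\<lambda>i. i \<in> K"]) auto
  qed (use assms in auto)
  moreover have "card ((\<lambda>J. N - J) ` ?L) = card ?L"
    by (rule card_image) (auto simp: inj_on_def)
  moreover have "card ((\<lambda>X i. i \<in> X) ` ?G) = card ?G"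
    by (rule card_image) (auto simp: inj_on_def fun_eq_iff)
  moreover have "card ?L = card (Pow N) - card \<J>" "card \<J> \<le> card (Pow N)"
    "card ?G = card (Pow N) - card F" "card F \<le> card (Pow N)"
    using assms(1) sub by (auto intro!: card_Diff_subset card_mono intro: finite_subset)
  ultimately have "card F \<le> card \<J>"
    by linarith
  then show ?thesis
    unfolding F_def \<J>_def .
qed

section \<open>Exposing functionals and sums of segments\<close>

lemma extreme_point_unique_maximum:
  fixes Q :: "'a::euclidean_space set"
  assumes "polytope Q" "x extreme_point_of Q"
  obtains c where "x \<in> Q" "\<And>y. y \<in> Q \<Longrightarrow> y \<noteq> x \<Longrightarrow> c \<bullet> y < c \<bullet> x"
proof -
  \<comment> \<open>All faces of a polyhedron are exposed, in particular those consisting of one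
    point.\<close>
  have "{x} exposed_face_of Q"
    using assms by (simp add: exposed_face_of_polyhedron face_of_singleton polytope_imp_polyhedron)
  then obtain c b where c: "Q \<subseteq> {z. c \<bullet> z \<le> b}" "{x} = Q \<inter> {z. c \<bullet> z = b}"
    by (auto simp: exposed_face_of_def)
  show ?thesis
  proof
    show "x \<in> Q"
      using c by blast
    fix y assume y: "y \<in> Q" "y \<noteq> x"
    have "c \<bullet> x = b" "c \<bullet> y \<le> b" "c \<bullet> y \<noteq> b"
      using c y by blast+
    then show "c \<bullet> y < c \<bullet> x"
      by linarith
  qed
qed

lemma polytope_sum_sets:
  assumes "\<And>i. i \<in> I \<Longrightarrow> polytope (P i)"
  shows "polytope (\<Sum>i\<in>I. P i)"
proof -
  obtain V where V: "\<And>i. i \<in> I \<Longrightarrow> finite (V i) \<and> P i = convex hull V i"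
    using assms unfolding polytope_def by metis
  have "(\<Sum>i\<in>I. P i) = convex hull (\<Sum>i\<in>I. V i)"
    by (simp add: convex_hull_set_sum V)
  moreover have "finite (\<Sum>i\<in>I. V i)"
    using V by (intro finite_set_sum) auto
  ultimately show ?thesis
    unfolding polytope_def by blast
qed

lemma unique_maximum_closed_segment:
  fixes a b c x :: "'a::euclidean_space"
  assumes "a \<noteq> b" "x \<in> closed_segment a b"
    and max: "\<And>z. z \<in> closed_segment a b \<Longrightarrow> z \<noteq> x \<Longrightarrow> c \<bullet> z < c \<bullet> x"
  shows "c \<bullet> (b - a) > 0 \<and> x = b \<or> c \<bullet> (b - a) < 0 \<and> x = a"
proof -
  have "closed_segment a b \<subseteq> {z. c \<bullet> z \<le> Orderings.max (c \<bullet> a) (c \<bullet> b)}"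
    unfolding segment_convex_hull by (intro hull_minimal convex_halfspace_le) auto
  then have "c \<bullet> x \<le> Orderings.max (c \<bullet> a) (c \<bullet> b)"
    using assms(2) by auto
  moreover have "x = a \<or> c \<bullet> a < c \<bullet> x" "x = b \<or> c \<bullet> b < c \<bullet> x"
    using max[of a] max[of b] by auto
  ultimately show ?thesis
    using assms(1) by (auto simp: inner_diff_right max_def split: if_splits)
qed

text \<open>A functional exposing a vertex is nonzero on every segment direction, and its signs
  determine the vertex. Negating the functional exchanges the two signs at \<open>k\<close>, whence
  the factor two.\<close>

lemma card_vertices_sum_segments_le:
  fixes a b :: "'i \<Rightarrow> 'a::euclidean_space"
  assumes "finite N" "k \<notin> N" and ab: "\<And>i. i \<in> insert k N \<Longrightarrow> a i \<noteq> b i"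
  shows "card (vertices (\<Sum>i\<in>insert k N. closed_segment (a i) (b i)))
    \<le> 2 * card {J. J \<subseteq> N \<and> card J < DIM('a)}"
proof -
  let ?I = "insert k N" and ?s = "\<lambda>i. b i - a i"
  let ?Q = "\<Sum>i\<in>?I. closed_segment (a i) (b i)"
  let ?F = "{X. X \<subseteq> N \<and> (\<exists>c. c \<bullet> ?s k > 0 \<and> (\<forall>i\<in>N. if i \<in> X then c \<bullet> ?s i > 0 else c \<bullet> ?s i < 0))}"
  let ?f = "\<lambda>X. \<Sum>i\<in>?I. if i \<in> X then b i else a i"
  have I: "finite ?I"
    using assms(1) by simp
  have "vertices ?Q \<subseteq> ?f ` (insert k ` ?F \<union> (\<lambda>X. N - X) ` ?F)"
  proof
    fix x assume "x \<in> vertices ?Q"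
    moreover have "polytope ?Q"
      by (intro polytope_sum_sets) (simp add: segment_convex_hull polytope_convex_hull)
    ultimately obtain c where "x \<in> ?Q" and c: "\<And>y. y \<in> ?Q \<Longrightarrow> y \<noteq> x \<Longrightarrow> c \<bullet> y < c \<bullet> x"
      using extreme_point_unique_maximum unfolding vertices_def by blast
    then obtain y where y: "x = sum y ?I" "\<And>i. i \<in> ?I \<Longrightarrow> y i \<in> closed_segment (a i) (b i)"
      unfolding set_sum_alt[OF I] by blast
    have sgn: "c \<bullet> ?s i > 0 \<and> y i = b i \<or> c \<bullet> ?s i < 0 \<and> y i = a i" if i: "i \<in> ?I" for i
    proof (rule unique_maximum_closed_segment)
      fix z assume z: "z \<in> closed_segment (a i) (b i)" "z \<noteq> y i"
      \<comment> \<open>Exchanging one summand stays inside the Minkowski sum, so strict maximality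
        of \<open>x\<close> passes to each \<open>y i\<close>.\<close>
      have *: "sum (y(i := z)) ?I = x - y i + z"
      proof -
        have "sum (y(i := z)) (?I - {i}) = sum y (?I - {i})"
          by (intro sum.cong) auto
        then show ?thesis
          unfolding y(1) sum.remove[OF I i] by simp
      qed
      have "sum (y(i := z)) ?I \<in> ?Q"
        unfolding set_sum_alt[OF I] using y(2) z(1) by force
      then show "c \<bullet> z < c \<bullet> y i"
        using c[of "x - y i + z"] z(2) unfolding * by (simp add: inner_diff_right inner_add_right)
    qed (use i ab y in auto)
    show "x \<in> ?f ` (insert k ` ?F \<union> (\<lambda>X. N - X) ` ?F)"
    proof (cases "c \<bullet> ?s k > 0")
      case True
      let ?X = "{i \<in> N. c \<bullet> ?s i > 0}"
      have "?X \<in> ?F"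
        using True sgn by force
      moreover have "x = ?f (insert k ?X)"
        unfolding y(1) using True sgn assms(2) by (intro sum.cong) fastforce+
      ultimately show ?thesis
        by blast
    next
      case False
      \<comment> \<open>This is the positive pattern of \<open>- c\<close>, so the endpoints
        \<open>b i\<close> are taken on its complement in \<open>N\<close>, and \<open>a k\<close>
        at \<open>k\<close>.\<close>
      let ?X = "{i \<in> N. c \<bullet> ?s i < 0}"
      have "- c \<bullet> ?s k > 0"
        using False sgn[of k] by simp
      moreover have "\<forall>i\<in>N. if i \<in> ?X then - c \<bullet> ?s i > 0 else - c \<bullet> ?s i < 0"
        using sgn by fastforce
      ultimately have "?X \<in> ?F"
        by blast
      moreover have "x = ?f (N - ?X)"
        unfolding y(1) using False sgn assms(2) by (intro sum.cong) fastforce+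
      ultimately show ?thesis
        by blast
    qed
  qed
  moreover have F: "finite ?F"
    using assms(1) by (intro finite_subset[of ?F "Pow N"]) auto
  ultimately have "card (vertices ?Q) \<le> card (insert k ` ?F \<union> (\<lambda>X. N - X) ` ?F)"
    by (meson card_image_le card_mono finite_Un finite_imageI le_trans)
  also have "\<dots> \<le> card (insert k ` ?F) + card ((\<lambda>X. N - X) ` ?F)"
    by (rule card_Un_le)
  also have "\<dots> \<le> card ?F + card ?F"
    using F by (intro add_mono card_image_le)
  also have "\<dots> \<le> 2 * card {J. J \<subseteq> N \<and> card J < DIM('a)}"
    using card_positive_sign_patterns_le[OF assms(1,2), of ?s] by simp
  finally show ?thesis .
qed

section \<open>Vertices of Minkowski sums in general position\<close>

lemma max_face_face_of:
  assumes "convex P"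
  shows "max_face ((\<bullet>) u) P face_of P"
proof (cases "max_face ((\<bullet>) u) P = {}")
  case False
  then obtain x where x: "x \<in> P" "\<And>y. y \<in> P \<Longrightarrow> u \<bullet> y \<le> u \<bullet> x"
    by (auto simp: max_face_def)
  have "z \<in> max_face ((\<bullet>) u) P \<longleftrightarrow> u \<bullet> z = u \<bullet> x" if "z \<in> P" for z
    using that x order_antisym[OF x(2)[OF that]] by (auto simp: max_face_def)
  then have "max_face ((\<bullet>) u) P = P \<inter> {z. u \<bullet> z = u \<bullet> x}"
    by (auto simp: max_face_def)
  then show ?thesis
    using face_of_Int_supporting_hyperplane_le[OF assms x(2)] by simp
qed simp

lemma polytope_eq_hull_vertices:
  "polytope P \<Longrightarrow> P = convex hull vertices P"
  unfolding vertices_def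
  by (intro Krein_Milman_Minkowski polytope_imp_compact polytope_imp_convex)

lemma finite_vertices: "polytope P \<Longrightarrow> finite (vertices P)"
  unfolding vertices_def by (intro finite_polyhedron_extreme_points polytope_imp_polyhedron)

text \<open>Extreme points of a face are those of \<open>P\<close> lying in it, and a linear bound
  on the vertices extends to their hull. This reduces faces of polytopes to finite sets, where the
  perturbation lemmas apply.\<close>

lemma vertices_max_face:
  assumes "polytope P"
  shows "vertices (max_face ((\<bullet>) u) P) = max_face ((\<bullet>) u) (vertices P)"
proof -
  have "vertices (max_face ((\<bullet>) u) P) = vertices P \<inter> max_face ((\<bullet>) u) P"
    using extreme_point_of_face[OF max_face_face_of[OF polytope_imp_convex[OF assms], of u]]
    by (auto simp: vertices_def)
  also have "\<dots> = max_face ((\<bullet>) u) (vertices P)"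
  proof (intro equalityI subsetI)
    fix x assume "x \<in> vertices P \<inter> max_face ((\<bullet>) u) P"
    then show "x \<in> max_face ((\<bullet>) u) (vertices P)"
      by (auto simp: max_face_def vertices_def extreme_point_of_def)
  next
    fix x assume x: "x \<in> max_face ((\<bullet>) u) (vertices P)"
    then have "convex hull vertices P \<subseteq> {y. u \<bullet> y \<le> u \<bullet> x}"
      by (intro hull_minimal convex_halfspace_le) (auto simp: max_face_def)
    then have "P \<subseteq> {y. u \<bullet> y \<le> u \<bullet> x}"
      using polytope_eq_hull_vertices[OF assms] by simp
    with x show "x \<in> vertices P \<inter> max_face ((\<bullet>) u) P"
      by (auto simp: max_face_def vertices_def extreme_point_of_def)
  qed
  finally show ?thesis .
qed

section \<open>Selecting one vertex from each face\<close>

lemma aff_dim_simplex_eq_card_vertices: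
  assumes "n simplex F"
  shows "aff_dim F = int (card (vertices F)) - 1"
proof -
  obtain C where C: "\<not> affine_dependent C" "int (card C) = n + 1" "F = convex hull C"
    using assms by (auto simp: simplex_def)
  then have "vertices F = C"
    by (auto simp: vertices_def extreme_point_of_convex_hull_affine_independent)
  then show ?thesis
    using C aff_dim_simplex[OF assms] by simp
qed

text \<open>The differences between \<open>x i\<close> and the other points of \<open>F i\<close>
  span the directions of the sum, and by the dimension hypothesis there are no more of them than its
  dimension. They are thus jointly independent, and a linear functional can equal \<open>1\<close>
  on all of them.\<close>

lemma exists_selecting_direction:
  fixes F :: "'i \<Rightarrow> 'a::euclidean_space set"
  assumes "finite I" and F: "\<And>i. i \<in> I \<Longrightarrow> finite (F i) \<and> x i \<in> F i"
    and dim: "(\<Sum>i\<in>I. int (card (F i)) - 1) \<le> aff_dim (\<Sum>i\<in>I. F i)"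
  shows "\<exists>w. \<forall>i\<in>I. max_face ((\<bullet>) w) (F i) = {x i}"
proof -
  define B where "B = (\<Union>i\<in>I. (\<lambda>z. x i - z) ` (F i - {x i}))"
  let ?X = "\<Sum>i\<in>I. F i"
  have fin: "finite B"
    using assms(1) F by (auto simp: B_def)
  have "sum x I \<in> ?X"
    unfolding set_sum_alt[OF assms(1)] using F by blast
  then have "aff_dim ?X = int (dim ((+) (- sum x I) ` ?X))"
    by (intro aff_dim_eq_dim hull_inc)
  also have "(+) (- sum x I) ` ?X \<subseteq> span B"
  proof
    fix y assume "y \<in> (+) (- sum x I) ` ?X"
    then obtain z where z: "y = - sum x I + sum z I" "\<And>i. i \<in> I \<Longrightarrow> z i \<in> F i"
      unfolding set_sum_alt[OF assms(1)] by blast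
    have "y = (\<Sum>i\<in>I. - (x i - z i))"
      unfolding z(1) by (simp add: sum_subtractf)
    also have "\<dots> \<in> span B"
    proof (intro span_sum span_neg)
      fix i assume "i \<in> I"
      then show "x i - z i \<in> span B"
        using z(2) by (cases "z i = x i") (auto simp: B_def span_zero intro!: span_base)
    qed
    finally show "y \<in> span B" .
  qed
  then have "int (dim ((+) (- sum x I) ` ?X)) \<le> int (dim (span B))"
    by (simp add: dim_subset del: dim_span)
  finally have "(\<Sum>i\<in>I. int (card (F i)) - 1) \<le> int (dim (span B))"
    using dim by simp
  moreover have "int (card B) \<le> (\<Sum>i\<in>I. int (card (F i)) - 1)"
  proof -
    have "card B \<le> (\<Sum>i\<in>I. card ((\<lambda>z. x i - z) ` (F i - {x i})))"
      unfolding B_def by (intro card_UN_le assms(1))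
    also have "\<dots> \<le> (\<Sum>i\<in>I. card (F i - {x i}))"
      using F by (intro sum_mono card_image_le) auto
    finally have "int (card B) \<le> (\<Sum>i\<in>I. int (card (F i - {x i})))"
      by (metis of_nat_le_iff of_nat_sum)
    also have "\<dots> = (\<Sum>i\<in>I. int (card (F i)) - 1)"
    proof (rule sum.cong)
      fix i assume "i \<in> I"
      with F have "finite (F i)" "x i \<in> F i"
        by auto
      moreover from this have "card (F i) > 0"
        by (auto simp: card_gt_0_iff)
      ultimately show "int (card (F i - {x i})) = int (card (F i)) - 1"
        by simp
    qed simp
    finally show ?thesis .
  qed
  ultimately have "independent B"
    using card_le_dim_spanning[of B "span B"] fin span_superset[of B] by simp
  then obtain g :: "'a \<Rightarrow> real" where g: "linear g" "\<forall>y\<in>B. g y = 1"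
    using linear_independent_extend[of B "\<lambda>_. 1"] by blast
  have w: "adjoint g 1 \<bullet> y = g y" for y
    using adjoint_works[OF g(1), of y 1] by (simp add: inner_commute)
  have "max_face ((\<bullet>) (adjoint g 1)) (F i) = {x i}" if i: "i \<in> I" for i
  proof -
    have "g z < g (x i)" if "z \<in> F i" "z \<noteq> x i" for z
    proof -
      have "g (x i - z) = 1"
        using g(2) that i by (auto simp: B_def)
      then show ?thesis
        by (simp add: linear_diff[OF g(1)])
    qed
    then show ?thesis
      using F[OF i] unfolding max_face_def w by force
  qed
  then show ?thesis
    by blast
qed

text \<open>General position makes the faces at \<open>u\<close> simplices whose dimensions add,
  which is what the preceding lemma asks for. Tilting \<open>u\<close> slightly by the resulting
  \<open>w\<close> breaks every tie in favour of \<open>x i\<close>.\<close>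

lemma general_position_exists_selecting_direction:
  fixes P :: "nat \<Rightarrow> 'a::euclidean_space set"
  assumes poly: "\<And>i. i \<in> {1..m} \<Longrightarrow> polytope (P i)" and gp: "general_position m P" and "u \<noteq> 0"
    and x: "\<And>i. i \<in> {1..m} \<Longrightarrow> x i \<in> max_face ((\<bullet>) u) (vertices (P i))"
  shows "\<exists>c. \<forall>i\<in>{1..m}. max_face ((\<bullet>) c) (vertices (P i)) = {x i}"
proof -
  let ?F = "\<lambda>i. max_face ((\<bullet>) u) (vertices (P i))"
  have "linear ((\<bullet>) u)" "(\<bullet>) u \<noteq> (\<lambda>_. 0)"
    using \<open>u \<noteq> 0\<close> by (auto simp: fun_eq_iff intro!: bounded_linear.linear bounded_linear_inner_right)
  then have simplex: "\<And>i. i \<in> {1..m} \<Longrightarrow> \<exists>n. n simplex max_face ((\<bullet>) u) (P i)"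
    and dim: "aff_dim (\<Sum>i\<in>{1..m}. max_face ((\<bullet>) u) (P i)) = (\<Sum>i\<in>{1..m}. aff_dim (max_face ((\<bullet>) u) (P i)))"
    using gp unfolding general_position_def by blast+
  have face: "max_face ((\<bullet>) u) (P i) = convex hull ?F i" if "i \<in> {1..m}" for i
  proof -
    have "polytope (max_face ((\<bullet>) u) (P i))"
      using simplex[OF that] simplex_imp_polytope by blast
    then show ?thesis
      using polytope_eq_hull_vertices vertices_max_face[OF poly[OF that]] by metis
  qed
  have "(\<Sum>i\<in>{1..m}. int (card (?F i)) - 1) = (\<Sum>i\<in>{1..m}. aff_dim (max_face ((\<bullet>) u) (P i)))"
  proof (rule sum.cong)
    fix i assume i: "i \<in> {1..m}"
    obtain n where "n simplex max_face ((\<bullet>) u) (P i)"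
      using simplex[OF i] by blast
    then show "int (card (?F i)) - 1 = aff_dim (max_face ((\<bullet>) u) (P i))"
      using aff_dim_simplex_eq_card_vertices vertices_max_face[OF poly[OF i]] by metis
  qed simp
  also have "\<dots> = aff_dim (convex hull (\<Sum>i\<in>{1..m}. ?F i))"
    unfolding dim[symmetric] convex_hull_set_sum
    by (intro arg_cong[of _ _ aff_dim] sum.cong refl face)
  also have "\<dots> = aff_dim (\<Sum>i\<in>{1..m}. ?F i)"
    by (rule aff_dim_convex_hull)
  finally have "\<exists>w. \<forall>i\<in>{1..m}. max_face ((\<bullet>) w) (?F i) = {x i}"
    using x poly by (intro exists_selecting_direction) (auto intro!: finite_max_face finite_vertices)
  then obtain w where w: "\<And>i. i \<in> {1..m} \<Longrightarrow> max_face ((\<bullet>) w) (?F i) = {x i}"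
    by blast
  have "\<forall>\<^sub>F e in at_right 0. \<forall>i\<in>{1..m}.
      max_face ((\<bullet>) (u + e *\<^sub>R w)) (vertices (P i)) = max_face ((\<bullet>) w) (?F i)"
    using poly by (intro eventually_ball_finite ballI eventually_max_face_perturb finite_vertices) auto
  then show ?thesis
    using eventually_happens'[OF trivial_limit_at_right_real] w by fastforce
qed

section \<open>Vertices of the sum as tuples\<close>

text \<open>\<open>PiE\<close> fixes the values off \<open>I\<close>, so that counting functions
  counts tuples.\<close>

definition selectable :: "'i set \<Rightarrow> ('i \<Rightarrow> 'a::euclidean_space set) \<Rightarrow> ('i \<Rightarrow> 'a) set" where
  "selectable I V = {v \<in> PiE I V. \<exists>c. \<forall>i\<in>I. max_face ((\<bullet>) c) (V i) = {v i}}"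

lemma finite_selectable: "finite I \<Longrightarrow> (\<And>i. i \<in> I \<Longrightarrow> finite (V i)) \<Longrightarrow> finite (selectable I V)"
  unfolding selectable_def by (rule finite_subset[of _ "PiE I V"]) (auto intro: finite_PiE)

text \<open>A tuple that does at least as well as \<open>v\<close> under the functional selecting
  \<open>v\<close> equals \<open>v\<close>. So the sum of \<open>v\<close> is the only maximiser,
  hence a vertex, and it determines \<open>v\<close>.\<close>

lemma card_selectable_vertices_le:
  fixes P :: "'i \<Rightarrow> 'a::euclidean_space set"
  assumes "finite I" and poly: "\<And>i. i \<in> I \<Longrightarrow> polytope (P i)"
  shows "card (selectable I (\<lambda>i. vertices (P i))) \<le> card (vertices (\<Sum>i\<in>I. P i))"
proof (rule card_inj_on_le)
  let ?Q = "\<Sum>i\<in>I. P i"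
  have unique: "\<forall>i\<in>I. y i = v i"
    if c: "\<forall>i\<in>I. max_face ((\<bullet>) c) (vertices (P i)) = {v i}" and y: "\<And>i. i \<in> I \<Longrightarrow> y i \<in> P i"
      and le: "c \<bullet> sum v I \<le> c \<bullet> sum y I" for c v y
  proof (rule ccontr)
    assume "\<not> (\<forall>i\<in>I. y i = v i)"
    then obtain j where j: "j \<in> I" "y j \<noteq> v j"
      by blast
    have face: "max_face ((\<bullet>) c) (P i) = {v i}" if "i \<in> I" for i
    proof -
      have "polytope (max_face ((\<bullet>) c) (P i))"
        using max_face_face_of[OF polytope_imp_convex] face_of_polytope_polytope poly[OF that] by blast
      then show ?thesis
        using polytope_eq_hull_vertices vertices_max_face[OF poly[OF that]] c that
        by (metis convex_hull_singleton)
    qed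
    have le: "c \<bullet> y i \<le> c \<bullet> v i" if "i \<in> I" for i
      using face[OF that] y[OF that] by (auto simp: max_face_def)
    moreover have "c \<bullet> y j < c \<bullet> v j"
    proof (rule ccontr)
      assume "\<not> c \<bullet> y j < c \<bullet> v j"
      moreover have "\<forall>z\<in>P j. c \<bullet> z \<le> c \<bullet> v j"
        using face[OF j(1)] by (auto simp: max_face_def)
      ultimately have "y j \<in> max_face ((\<bullet>) c) (P j)"
        using y[OF j(1)] by (fastforce simp: max_face_def)
      then show False
        using face j by simp
    qed
    ultimately have "(\<Sum>i\<in>I. c \<bullet> y i) < (\<Sum>i\<in>I. c \<bullet> v i)"
      using j(1) assms(1) by (intro sum_strict_mono_ex1) auto
    then show False
      using \<open>c \<bullet> sum v I \<le> c \<bullet> sum y I\<close> by (simp add: inner_sum_right)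
  qed
  have mem: "v i \<in> P i" if "v \<in> selectable I (\<lambda>i. vertices (P i))" "i \<in> I" for v i
    using that by (auto simp: selectable_def vertices_def extreme_point_of_def)
  show "inj_on (\<lambda>v. sum v I) (selectable I (\<lambda>i. vertices (P i)))"
  proof (rule inj_onI)
    fix v y
    assume v: "v \<in> selectable I (\<lambda>i. vertices (P i))"
      and y: "y \<in> selectable I (\<lambda>i. vertices (P i))" and eq: "sum v I = sum y I"
    obtain c where "\<forall>i\<in>I. max_face ((\<bullet>) c) (vertices (P i)) = {v i}"
      using v by (auto simp: selectable_def)
    then have "\<forall>i\<in>I. y i = v i"
      using unique mem[OF y] eq by simp
    then show "v = y"
      using v y by (intro PiE_ext[of v I "\<lambda>i. vertices (P i)" y]) (auto simp: selectable_def)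
  qed
  show "(\<lambda>v. sum v I) ` selectable I (\<lambda>i. vertices (P i)) \<subseteq> vertices ?Q"
  proof
    fix x assume "x \<in> (\<lambda>v. sum v I) ` selectable I (\<lambda>i. vertices (P i))"
    then obtain v where x: "x = sum v I" and v: "v \<in> selectable I (\<lambda>i. vertices (P i))"
      by blast
    then obtain c where c: "\<forall>i\<in>I. max_face ((\<bullet>) c) (vertices (P i)) = {v i}"
      by (auto simp: selectable_def)
    have "max_face ((\<bullet>) c) ?Q = {x}"
    proof -
      have eq: "z = x" if z: "z \<in> ?Q" "c \<bullet> x \<le> c \<bullet> z" for z
      proof -
        obtain y where y: "z = sum y I" "\<And>i. i \<in> I \<Longrightarrow> y i \<in> P i"
          using z(1) unfolding set_sum_alt[OF assms(1)] by blast
        then show ?thesis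
          using unique[OF c y(2)] z(2) x by simp
      qed
      moreover have "x \<in> ?Q"
        unfolding set_sum_alt[OF assms(1)] using mem[OF v] x by blast
      ultimately show ?thesis
        unfolding max_face_def by (smt (verit, del_insts) Collect_cong singleton_conv)
    qed
    moreover have "max_face ((\<bullet>) c) ?Q face_of ?Q"
      using poly by (intro max_face_face_of polytope_imp_convex polytope_sum_sets)
    ultimately show "x \<in> vertices ?Q"
      by (simp add: vertices_def face_of_singleton)
  qed
  show "finite (vertices ?Q)"
    using poly by (intro finite_vertices polytope_sum_sets)
qed

text \<open>Double counting of the pairs related by \<open>R\<close>: each \<open>J\<close> has two
  partners \<open>a\<close>, and the partners of a given \<open>a\<close> are strongly shattered in
  its fibre \<open>A a\<close>. The assumption \<open>select\<close> is the form in which general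
  position enters.\<close>

lemma card_selectable_ge:
  fixes V :: "'i \<Rightarrow> 'a::euclidean_space set"
  assumes "finite N" "k \<notin> N" and V: "\<And>i. i \<in> insert k N \<Longrightarrow> finite (V i) \<and> 2 \<le> card (V i)"
    and select: "\<And>u x. u \<noteq> 0 \<Longrightarrow> (\<And>i. i \<in> insert k N \<Longrightarrow> x i \<in> max_face ((\<bullet>) u) (V i)) \<Longrightarrow>
      \<exists>c. \<forall>i\<in>insert k N. max_face ((\<bullet>) c) (V i) = {x i}"
  shows "2 * card {J. J \<subseteq> N \<and> card J < DIM('a)} \<le> card (selectable (insert k N) V)"
proof -
  let ?I = "insert k N"
  define \<J> where "\<J> = {J. J \<subseteq> N \<and> card J < DIM('a)}"
  define R where "R a J \<longleftrightarrow> (\<exists>u. u \<noteq> 0 \<and> a \<in> max_face ((\<bullet>) u) (V k) \<and>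
    (\<forall>i\<in>J. 2 \<le> card (max_face ((\<bullet>) u) (V i))))" for a J
  define A where "A a = {v \<in> selectable ?I V. v k = a}" for a
  have fin: "finite \<J>" "finite (selectable ?I V)" "finite (V k)"
    using assms(1) V by (auto simp: \<J>_def intro!: finite_selectable)
  have two: "2 \<le> card {a \<in> V k. R a J}" if J: "J \<in> \<J>" for J
  proof -
    have direction: "\<exists>u. u \<noteq> 0 \<and> s \<bullet> u \<le> 0 \<and> (\<forall>i\<in>J. 2 \<le> card (max_face ((\<bullet>) u) (V i)))" for s
      using exists_common_nonvertex_direction[of J V UNIV s] J V assms(1)
      by (auto simp: \<J>_def intro: finite_subset)
    obtain u a where u: "u \<noteq> 0" "\<forall>i\<in>J. 2 \<le> card (max_face ((\<bullet>) u) (V i))" "a \<in> max_face ((\<bullet>) u) (V k)"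
      using direction[of 0] max_face_nonempty[of "V k"] V[of k] by fastforce
    then have a: "R a J" "a \<in> V k"
      using max_face_subset by (auto simp: R_def)
    then obtain b where b: "b \<in> V k" "b \<noteq> a"
      using V[of k] by (metis card_le_Suc0_iff_eq insertI1 not_less_eq_eq numeral_2_eq_2)
    \<comment> \<open>In this half-space \<open>b\<close> is at least as good as \<open>a\<close>,
      so \<open>a\<close> cannot be the only maximiser.\<close>
    obtain u where u: "u \<noteq> 0" "(a - b) \<bullet> u \<le> 0" "\<forall>i\<in>J. 2 \<le> card (max_face ((\<bullet>) u) (V i))"
      using direction by blast
    obtain a' where a': "a' \<in> max_face ((\<bullet>) u) (V k)" "a' \<noteq> a"
    proof (cases "a \<in> max_face ((\<bullet>) u) (V k)")
      case True
      moreover have "u \<bullet> a \<le> u \<bullet> b"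
        using u(2) by (simp add: inner_diff_left inner_commute[of u])
      ultimately have "b \<in> max_face ((\<bullet>) u) (V k)"
        using b(1) by (fastforce simp: max_face_def)
      then show ?thesis
        using that b(2) by blast
    next
      case False
      then show ?thesis
        using that max_face_nonempty[of "V k" u] V[of k] by fastforce
    qed
    then have "R a' J" "a' \<in> V k"
      using u max_face_subset by (auto simp: R_def)
    then have "{a, a'} \<subseteq> {a \<in> V k. R a J}"
      using a by blast
    then have "card {a, a'} \<le> card {a \<in> V k. R a J}"
      using fin(3) by (intro card_mono) auto
    then show ?thesis
      using a'(2) by simp
  qed
  have fibre: "card {J \<in> \<J>. R a J} \<le> card (A a)" for a
  proof (rule card_strongly_shattered_le)
    show "finite (A a)"
      using fin(2) by (simp add: A_def)
    show "f i = g i" if "f \<in> A a" "g \<in> A a" "i \<notin> N" for f g i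
      using that by (cases "i = k") (auto simp: A_def selectable_def PiE_def extensional_def)
    fix J assume "J \<in> {J \<in> \<J>. R a J}"
    then obtain u where J: "J \<subseteq> N" and u: "u \<noteq> 0" "a \<in> max_face ((\<bullet>) u) (V k)"
      "\<forall>i\<in>J. 2 \<le> card (max_face ((\<bullet>) u) (V i))"
      by (auto simp: \<J>_def R_def)
    let ?F = "\<lambda>i. max_face ((\<bullet>) u) (V i)"
    have "\<exists>p q. p \<in> ?F i \<and> q \<in> ?F i \<and> (i \<in> J \<longrightarrow> p \<noteq> q)" if i: "i \<in> N" for i
    proof (cases "i \<in> J")
      case True
      then have "\<not> card (?F i) \<le> Suc 0"
        using u(3) by fastforce
      then show ?thesis
        using card_le_Suc0_iff_eq[OF finite_max_face] V i by blast
    next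
      case False
      then show ?thesis
        using max_face_nonempty[of "V i" u] V[of i] i by fastforce
    qed
    then obtain p q where pq: "\<And>i. i \<in> N \<Longrightarrow> p i \<in> ?F i \<and> q i \<in> ?F i \<and> (i \<in> J \<longrightarrow> p i \<noteq> q i)"
      by metis
    \<comment> \<open>The values \<open>a\<close> at \<open>k\<close> and \<open>undefined\<close>
      off the index set keep the whole cube in the fibre over \<open>a\<close>.\<close>
    define q' where "q' i = (if i = k then a else if i \<in> N then q i else undefined)" for i
    have "(\<lambda>i. if i \<in> K then p i else q' i) \<in> A a" if K: "K \<subseteq> J" for K
    proof -
      let ?v = "\<lambda>i. if i \<in> K then p i else q' i"
      \<comment> \<open>All corners of the cube choose from the faces of the same \<open>u\<close>,
        so \<open>select\<close> applies to each of them.\<close>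
      have v: "?v i \<in> ?F i" if "i \<in> ?I" for i
        using that K J pq u(2) assms(2) by (auto simp: q'_def)
      have "?v \<in> PiE ?I V"
      proof (rule PiE_I)
        show "?v i \<in> V i" if "i \<in> ?I" for i
          using v[OF that] max_face_subset by blast
        show "?v i = undefined" if "i \<notin> ?I" for i
          using that K J by (auto simp: q'_def)
      qed
      moreover have "?v k = a"
        using K J assms(2) by (auto simp: q'_def)
      ultimately show ?thesis
        using select[OF u(1) v] by (simp add: A_def selectable_def)
    qed
    moreover have "\<forall>i\<in>J. p i \<noteq> q' i"
      using pq J assms(2) by (auto simp: q'_def)
    ultimately show "J \<subseteq> N \<and> strongly_shattered (A a) J"
      using J unfolding strongly_shattered_def by blast
  qed (rule assms(1))
  have "2 * card \<J> \<le> (\<Sum>J\<in>\<J>. card {a \<in> V k. R a J})"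
    using sum_mono[of \<J> "\<lambda>_. 2" "\<lambda>J. card {a \<in> V k. R a J}"] two by simp
  also have "\<dots> = (\<Sum>a\<in>V k. card {J \<in> \<J>. R a J})"
    using sum.swap_restrict[OF fin(1,3), of "\<lambda>_ _. 1 :: nat" "\<lambda>J a. R a J"] by simp
  also have "\<dots> \<le> (\<Sum>a\<in>V k. card (A a))"
    by (intro sum_mono fibre)
  also have "\<dots> = card (\<Union>a\<in>V k. A a)"
    using fin by (intro card_UN_disjoint[symmetric]) (auto simp: A_def)
  also have "\<dots> \<le> card (selectable ?I V)"
    using fin(2) by (intro card_mono) (auto simp: A_def)
  finally show ?thesis
    unfolding \<J>_def .
qed

theorem corollary8p2:
  fixes P S :: "nat \<Rightarrow> (real ^ 'd) set" and m :: nat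
  assumes "m \<ge> 1"
    and "\<And>i. i \<in> {1..m} \<Longrightarrow> polytope (P i)"
    and "\<And>i. i \<in> {1..m} \<Longrightarrow> aff_dim (P i) > 0"
    and "general_position m P"
    and "\<And>i. i \<in> {1..m} \<Longrightarrow> \<exists>a b. a \<noteq> b \<and> S i = closed_segment a b"
    and "general_position m S"
  shows "card (vertices (\<Sum>i\<in>{1..m}. S i)) \<le> card (vertices (\<Sum>i\<in>{1..m}. P i))"
proof -
  \<comment> \<open>The last index is split off as the distinguished one, whose sign or vertex is
    fixed in the two counts.\<close>
  have I: "{1..m} = insert m {1..<m}"
    using assms(1) by auto
  have V: "finite (vertices (P i)) \<and> 2 \<le> card (vertices (P i))" if "i \<in> {1..m}" for i
  proof -
    have "finite (vertices (P i))"
      using assms(2)[OF that] by (rule finite_vertices)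
    \<comment> \<open>The hull of \<open>n\<close> points has affine dimension at most
      \<open>n - 1\<close>, so positive dimension forces two vertices.\<close>
    moreover have "aff_dim (P i) \<le> int (card (vertices (P i))) - 1"
      using polytope_eq_hull_vertices[OF assms(2)[OF that]] aff_dim_le_card[OF calculation]
      by (metis aff_dim_convex_hull)
    ultimately show ?thesis
      using assms(3)[OF that] by simp
  qed
  obtain a b where ab: "\<And>i. i \<in> {1..m} \<Longrightarrow> a i \<noteq> b i \<and> S i = closed_segment (a i) (b i)"
    using assms(5) by metis
  have "(\<Sum>i\<in>{1..m}. S i) = (\<Sum>i\<in>{1..m}. closed_segment (a i) (b i))"
    using ab by (intro sum.cong) auto
  then have "card (vertices (\<Sum>i\<in>{1..m}. S i)) \<le> 2 * card {J. J \<subseteq> {1..<m} \<and> card J < DIM(real ^ 'd)}"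
    using card_vertices_sum_segments_le[of "{1..<m}" m a b] ab unfolding I by simp
  also have "\<dots> \<le> card (selectable {1..m} (\<lambda>i. vertices (P i)))"
    unfolding I
  proof (rule card_selectable_ge)
    show "\<exists>c. \<forall>i\<in>insert m {1..<m}. max_face ((\<bullet>) c) (vertices (P i)) = {x i}"
      if "u \<noteq> 0" "\<And>i. i \<in> insert m {1..<m} \<Longrightarrow> x i \<in> max_face ((\<bullet>) u) (vertices (P i))" for u x
      using general_position_exists_selecting_direction[of m P u x] assms(2,4) that
      unfolding I by blast
    show "finite (vertices (P i)) \<and> 2 \<le> card (vertices (P i))" if "i \<in> insert m {1..<m}" for i
      using V[of i] that unfolding I by blast
  qed auto
  also have "\<dots> \<le> card (vertices (\<Sum>i\<in>{1..m}. P i))"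
    using assms(2) by (intro card_selectable_vertices_le) auto
  finally show ?thesis .
qed

end
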